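(* Let $p$ be a prime, $n\ge1$, and let $H\le\mathcal{H}(p^n)$ with $H\nsubseteq Z(\mathcal{H}(p^n))$. Let $H^\dagger=H\setminus Z(\mathcal{H}(p^n))=\{h_1,\dots,h_m\}$. The canonical homomorphism $P(H)\to\prod_{i=1}^m P(h_i)$, $x\mapsto(x,\dots,x)$, induces an isomorphism $P(H)/C(H)\cong\mathbb{Z}_p^k$ with $k=1$ or $k=2$; that is, the induced homomorphism $P(H)/C(H)\to\prod_{i=1}^mP(h_i)/C(h_i)\cong\mathbb{Z}_p^m$ is an isomorphism onto its image, and this image is isomorphic to $\mathbb{Z}_p^k$ with $k\in\{1,2\}$.
   Context: For an integer $r\ge 1$, $\mathcal{H}(r)$ denotes the Heisenberg group of $3\times3$ upper unitriangular matrices over $\mathbb{Z}_r=\mathbb{Z}/r\mathbb{Z}$ (trivial if $r=1$). The matrix with $(1,2)$-entry $a_1$, $(1,3)$-entry $a_2$, $(2,3)$-entry $a_3$ is written $(a_1,a_2,a_3)$. Let $q:\mathcal{H}(p^n)\to\mathcal{H}(p^{n-1})$ be the surjective homomorphism reducing each component mod $p^{n-1}$. With $[x,y]=x^{-1}y^{-1}xy$, for a non-empty $S\subseteq\mathcal{H}(p^n)$ the pseudocentralizer is the subgroup $P(S)=\{g\in\mathcal{H}(p^n) : [s,g]\in\ker q\text{ for all }s\in S\}$, and $P(h)=P(\{h\})$. $C(S)$ is the centralizer of $S$ in $\mathcal{H}(p^n)$; it is a normal subgroup of $P(S)$. For non-central $h$, $P(h)/C(h)\cong\mathbb{Z}_p$.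 *)

theory Defs
  imports
    "HOL-Algebra.Product_Groups"
    "HOL-Computational_Algebra.Primes"
    "Jordan_Normal_Form.Matrix"
begin

text \<open>
  Matrices over \<open>\<int>/r\<int>\<close> are represented by integer matrices whose entries are the canonical
  residues \<open>0, \<dots>, r - 1\<close>. For \<open>r = 1\<close> every entry, including the diagonal ones, is \<open>0\<close>.
\<close>

definition mat_mod :: "nat \<Rightarrow> int mat \<Rightarrow> int mat" where
  "mat_mod r A = map_mat (\<lambda>x. x mod int r) A"

definition heis_mat :: "nat \<Rightarrow> int \<Rightarrow> int \<Rightarrow> int \<Rightarrow> int mat" where
  "heis_mat r a1 a2 a3 =
     mat_mod r (mat_of_rows_list 3 [[1, a1, a2],
                                    [0, 1, a3],
                                    [0, 0, 1]])"

definition heisenberg :: "nat \<Rightarrow> int mat monoid" where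
  "heisenberg r =
     \<lparr>carrier = {heis_mat r a1 a2 a3 | a1 a2 a3. True},
      monoid.mult = (\<lambda>A B. mat_mod r (A * B)),
      one = mat_mod r (1\<^sub>m 3)\<rparr>"

definition commutator :: "('a, 'b) monoid_scheme \<Rightarrow> 'a \<Rightarrow> 'a \<Rightarrow> 'a" where
  "commutator G x y = inv\<^bsub>G\<^esub> x \<otimes>\<^bsub>G\<^esub> inv\<^bsub>G\<^esub> y \<otimes>\<^bsub>G\<^esub> x \<otimes>\<^bsub>G\<^esub> y"

definition centralizer :: "('a, 'b) monoid_scheme \<Rightarrow> 'a set \<Rightarrow> 'a set" where
  "centralizer G S = {g \<in> carrier G. \<forall>s\<in>S. g \<otimes>\<^bsub>G\<^esub> s = s \<otimes>\<^bsub>G\<^esub> g}"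

definition center :: "('a, 'b) monoid_scheme \<Rightarrow> 'a set" where
  "center G = centralizer G (carrier G)"

definition heis_reduce :: "nat \<Rightarrow> nat \<Rightarrow> int mat \<Rightarrow> int mat" where
  "heis_reduce p n = mat_mod (p ^ (n - 1))"

definition pseudocentralizer :: "nat \<Rightarrow> nat \<Rightarrow> int mat set \<Rightarrow> int mat set" where
  "pseudocentralizer p n S =
     {g \<in> carrier (heisenberg (p ^ n)). \<forall>s\<in>S.
        commutator (heisenberg (p ^ n)) s g
          \<in> kernel (heisenberg (p ^ n)) (heisenberg (p ^ (n - 1))) (heis_reduce p n)}"

definition pseudocentralizer_group :: "nat \<Rightarrow> nat \<Rightarrow> int mat set \<Rightarrow> int mat monoid" where
  "pseudocentralizer_group p n S = (heisenberg (p ^ n))\<lparr>carrier := pseudocentralizer p n S\<rparr>"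

text \<open>The quotient \<open>P(S)/C(S)\<close>.\<close>

definition pc_quotient :: "nat \<Rightarrow> nat \<Rightarrow> int mat set \<Rightarrow> int mat set monoid" where
  "pc_quotient p n S = pseudocentralizer_group p n S Mod centralizer (heisenberg (p ^ n)) S"

definition cyclic_power :: "nat \<Rightarrow> nat \<Rightarrow> (nat \<Rightarrow> int) monoid" where
  "cyclic_power p k = product_group {..<k} (\<lambda>_. integer_mod_group p)"

end

theory Submission
  imports Defs "HOL-Number_Theory.Cong"
begin

text \<open>
  The commutator of \<open>(a\<^sub>1, a\<^sub>2, a\<^sub>3)\<close> and \<open>(b\<^sub>1, b\<^sub>2, b\<^sub>3)\<close> is \<open>(0, \<omega>, 0)\<close> with the symplectic
  form \<open>\<omega> = a\<^sub>1 b\<^sub>3 - b\<^sub>1 a\<^sub>3\<close>, so \<open>P(S)\<close> and \<open>C(S)\<close> consist of the \<open>g\<close> for which all \<open>\<omega>(s, g)\<close> are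
  divisible by \<open>p\<^bsup>n-1\<^esup>\<close> and by \<open>p\<^bsup>n\<^esup>\<close>, respectively. Modulo \<open>p\<^bsup>n\<^esup>\<close> the functionals
  \<open>\<omega>(s, -)\<close> are combinations of one or two of them, for which elements \<open>g\<close> with values
  \<open>(p\<^bsup>n-1\<^esup>, 0)\<close> and \<open>(0, p\<^bsup>n-1\<^esup>)\<close> exist. Dividing these values by \<open>p\<^bsup>n-1\<^esup>\<close> gives a surjection of
  \<open>P(S)\<close> onto \<open>\<int>\<^sub>p\<^sup>k\<close> with kernel \<open>C(S)\<close>. The map into the product of the \<open>P(h)/C(h)\<close> is injective
  because \<open>C(H)\<close> is the intersection of the \<open>C(h)\<close> over the non-central \<open>h\<close>.
\<close>

section \<open>The Heisenberg group in coordinates\<close>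

text \<open>Positions are spelled with \<open>Suc 0\<close> because the simplifier turns the index
  \<open>1\<close> into that form.\<close>

lemma heis_mat_index [simp]:
  "dim_row (heis_mat r a b c) = 3" "dim_col (heis_mat r a b c) = 3"
  "heis_mat r a b c $$ (0, 0) = 1 mod int r"
  "heis_mat r a b c $$ (0, Suc 0) = a mod int r"
  "heis_mat r a b c $$ (0, 2) = b mod int r"
  "heis_mat r a b c $$ (Suc 0, 0) = 0"
  "heis_mat r a b c $$ (Suc 0, Suc 0) = 1 mod int r"
  "heis_mat r a b c $$ (Suc 0, 2) = c mod int r"
  "heis_mat r a b c $$ (2, 0) = 0"
  "heis_mat r a b c $$ (2, Suc 0) = 0"
  "heis_mat r a b c $$ (2, 2) = 1 mod int r"
  by (simp_all add: heis_mat_def mat_mod_def mat_of_rows_list_def numeral_2_eq_2)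

text \<open>The diagonal entries are \<open>1 mod int r\<close>, so \<open>r = 1\<close>, where they
  collapse to \<open>0\<close>, is split off. The case \<open>r = 0\<close> falls under the second
  alternative.\<close>

lemma one_mod_int_cases: "int r = 1 \<or> 1 mod int r = 1"
  using zmod_trivial_iff[of 1 "int r"] by (cases "r = 0") auto

lemma less_3_cases: "i < 3 \<longleftrightarrow> i = 0 \<or> i = Suc 0 \<or> i = (2::nat)"
  by auto

lemma heis_mat_eq_iff:
  "heis_mat r a b c = heis_mat r a' b' c' \<longleftrightarrow>
     [a = a'] (mod int r) \<and> [b = b'] (mod int r) \<and> [c = c'] (mod int r)" (is "?L \<longleftrightarrow> ?R")
proof
  assume ?L
  then have "heis_mat r a b c $$ ij = heis_mat r a' b' c' $$ ij" for ij
    by simp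
  from this[of "(0, Suc 0)"] this[of "(0, 2)"] this[of "(Suc 0, 2)"] show ?R
    by (simp add: cong_def)
next
  assume ?R
  then show ?L
    by (intro eq_matI) (auto simp: less_3_cases cong_def)
qed

lemma mat_mod_heis_mat:
  assumes "r dvd s"
  shows "mat_mod r (heis_mat s a b c) = heis_mat r a b c"
  using assms
  by (intro eq_matI) (auto simp: mat_mod_def less_3_cases mod_mod_cancel)

lemma mat_mod_mult_heis_mat:
  "mat_mod r (heis_mat r a b c * heis_mat r a' b' c') =
     heis_mat r (a + a') (b + b' + a * c') (c + c')"
proof (intro eq_matI, goal_cases)
  case (1 i j)
  have s: "{0..<3} = {0, Suc 0, 2}"
    by auto
  have "int r = 1 \<or> 1 mod int r = 1"
    by (rule one_mod_int_cases)
  then show ?case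
  proof
    assume "int r = 1"
    with 1 show ?case
      by (auto simp: less_3_cases mat_mod_def heis_mat_def mat_of_rows_list_def)
  next
    assume 2: "1 mod int r = 1"
    \<comment> \<open>Only the corner entry multiplies two free coordinates; this congruence removes
      the reductions nested inside it.\<close>
    have "[b + (b' mod int r + a mod int r * (c' mod int r)) = b + (b' + a * c')] (mod int r)"
      by (intro cong_add cong_mult cong_refl) (simp_all add: cong_def)
    with 1 2 show ?case
      by (auto simp: less_3_cases mat_mod_def scalar_prod_def s mod_simps ac_simps cong_def)
  qed
qed (auto simp: mat_mod_def)

lemma carrier_heisenberg: "carrier (heisenberg r) = {heis_mat r a b c | a b c. True}"
  by (simp add: heisenberg_def)

lemma heis_mat_carrier [simp]: "heis_mat r a b c \<in> carrier (heisenberg r)"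
  by (auto simp: carrier_heisenberg)

lemma mult_heisenberg:
  "heis_mat r a b c \<otimes>\<^bsub>heisenberg r\<^esub> heis_mat r a' b' c' =
     heis_mat r (a + a') (b + b' + a * c') (c + c')"
  by (simp add: heisenberg_def mat_mod_mult_heis_mat)

lemma one_heisenberg: "\<one>\<^bsub>heisenberg r\<^esub> = heis_mat r 0 0 0"
  by (intro eq_matI) (auto simp: heisenberg_def mat_mod_def less_3_cases)

lemma heisenberg_cases:
  assumes "A \<in> carrier (heisenberg r)"
  obtains a b c where "A = heis_mat r a b c"
  using assms by (auto simp: carrier_heisenberg)

lemma group_heisenberg: "group (heisenberg r)"
proof (rule groupI)
  fix x assume "x \<in> carrier (heisenberg r)"
  then obtain a b c where x: "x = heis_mat r a b c"
    by (rule heisenberg_cases)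
  show "\<exists>y\<in>carrier (heisenberg r). y \<otimes>\<^bsub>heisenberg r\<^esub> x = \<one>\<^bsub>heisenberg r\<^esub>"
    \<comment> \<open>Solving \<open>(a', b', c') (a, b, c) = (0, 0, 0)\<close> gives
      \<open>a' = - a\<close>, \<open>c' = - c\<close> and then
      \<open>b' = - b - a' * c\<close>.\<close>
    by (rule bexI[of _ "heis_mat r (- a) (a * c - b) (- c)"])
       (simp_all add: x mult_heisenberg one_heisenberg)
qed (auto elim!: heisenberg_cases simp: mult_heisenberg one_heisenberg algebra_simps)

lemma inv_heisenberg: "inv\<^bsub>heisenberg r\<^esub> (heis_mat r a b c) = heis_mat r (- a) (a * c - b) (- c)"
  by (rule group.inv_equality[OF group_heisenberg]) (simp_all add: mult_heisenberg one_heisenberg)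

text \<open>Finiteness lets the non-central elements of \<open>H\<close> be enumerated by an initial
  segment of the naturals.\<close>

lemma finite_heisenberg:
  assumes "r > 0"
  shows "finite (carrier (heisenberg r))"
proof (rule finite_subset)
  show "carrier (heisenberg r) \<subseteq> (\<lambda>(a, b, c). heis_mat r a b c) ` ({0..<int r} \<times> {0..<int r} \<times> {0..<int r})"
  proof
    fix A assume "A \<in> carrier (heisenberg r)"
    then obtain a b c where "A = heis_mat r a b c"
      by (rule heisenberg_cases)
    then have "A = heis_mat r (a mod int r) (b mod int r) (c mod int r)"
      by (simp add: heis_mat_eq_iff cong_def)
    with assms show "A \<in> (\<lambda>(a, b, c). heis_mat r a b c) ` ({0..<int r} \<times> {0..<int r} \<times> {0..<int r})"
      by (intro image_eqI[where x = "(a mod int r, b mod int r, c mod int r)"]) auto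
  qed
qed auto

text \<open>The symplectic form in the first and third coordinates. Its value is left unreduced, so
  that divisibility by \<open>p ^ (n - 1)\<close> and by \<open>p ^ n\<close> is tested on the same
  integer.\<close>

definition heis_form :: "int mat \<Rightarrow> int mat \<Rightarrow> int" where
  "heis_form A B = A $$ (0, 1) * B $$ (1, 2) - B $$ (0, 1) * A $$ (1, 2)"

lemma heis_form_heis_mat:
  "[heis_form (heis_mat r a b c) (heis_mat r a' b' c') = a * c' - a' * c] (mod int r)"
  unfolding heis_form_def
  by (intro cong_diff cong_mult) (simp_all add: cong_def)

text \<open>Multiplication adds the two coordinates that the form reads, so
  \<open>heis_form A\<close> is a homomorphism into the residues modulo \<open>r\<close>.\<close>

lemma heis_form_mult_right:
  assumes "A \<in> carrier (heisenberg r)" "B \<in> carrier (heisenberg r)" "C \<in> carrier (heisenberg r)"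
  shows "[heis_form A (B \<otimes>\<^bsub>heisenberg r\<^esub> C) = heis_form A B + heis_form A C] (mod int r)"
proof -
  obtain a1 a2 a3 b1 b2 b3 c1 c2 c3 where
    eq: "A = heis_mat r a1 a2 a3" "B = heis_mat r b1 b2 b3" "C = heis_mat r c1 c2 c3"
    using assms by (meson heisenberg_cases)
  have "[heis_form A (B \<otimes>\<^bsub>heisenberg r\<^esub> C) = a1 * (b3 + c3) - (b1 + c1) * a3] (mod int r)"
    unfolding eq mult_heisenberg by (rule heis_form_heis_mat)
  also have "a1 * (b3 + c3) - (b1 + c1) * a3 = (a1 * b3 - b1 * a3) + (a1 * c3 - c1 * a3)"
    by (simp add: algebra_simps)
  also have "[\<dots> = heis_form A B + heis_form A C] (mod int r)"
    unfolding eq by (intro cong_add cong_sym[OF heis_form_heis_mat])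
  finally show ?thesis .
qed

lemma commutator_heisenberg:
  assumes "A \<in> carrier (heisenberg r)" "B \<in> carrier (heisenberg r)"
  shows "commutator (heisenberg r) A B = heis_mat r 0 (heis_form A B) 0"
proof -
  obtain a1 a2 a3 b1 b2 b3 where eq: "A = heis_mat r a1 a2 a3" "B = heis_mat r b1 b2 b3"
    using assms by (meson heisenberg_cases)
  have "commutator (heisenberg r) A B = heis_mat r 0 (a1 * b3 - b1 * a3) 0"
    by (simp add: commutator_def eq inv_heisenberg mult_heisenberg algebra_simps)
  also have "\<dots> = heis_mat r 0 (heis_form A B) 0"
    using heis_form_heis_mat[of r a1 a2 a3 b1 b2 b3] by (simp add: heis_mat_eq_iff eq cong_sym)
  finally show ?thesis .
qed

text \<open>The two products differ only in the middle coordinate, and there by the value of the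
  form.\<close>

lemma heisenberg_commute_iff:
  assumes "A \<in> carrier (heisenberg r)" "B \<in> carrier (heisenberg r)"
  shows "B \<otimes>\<^bsub>heisenberg r\<^esub> A = A \<otimes>\<^bsub>heisenberg r\<^esub> B \<longleftrightarrow> int r dvd heis_form A B"
proof -
  obtain a1 a2 a3 b1 b2 b3 where eq: "A = heis_mat r a1 a2 a3" "B = heis_mat r b1 b2 b3"
    using assms by (meson heisenberg_cases)
  have "B \<otimes>\<^bsub>heisenberg r\<^esub> A = A \<otimes>\<^bsub>heisenberg r\<^esub> B \<longleftrightarrow> int r dvd a1 * b3 - b1 * a3"
    by (simp add: eq mult_heisenberg heis_mat_eq_iff cong_iff_dvd_diff add.commute dvd_diff_commute
        cong_sym_eq algebra_simps)
  also have "\<dots> \<longleftrightarrow> int r dvd heis_form A B"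
    unfolding eq by (rule cong_dvd_iff[OF cong_sym[OF heis_form_heis_mat]])
  finally show ?thesis .
qed

lemma centralizer_heisenberg:
  assumes "S \<subseteq> carrier (heisenberg r)"
  shows "centralizer (heisenberg r) S = {g \<in> carrier (heisenberg r). \<forall>s\<in>S. int r dvd heis_form s g}"
  using assms by (auto simp: centralizer_def heisenberg_commute_iff subset_iff)

text \<open>Pairing with \<open>heis_mat r 1 0 0\<close> and \<open>heis_mat r 0 0 1\<close>
  recovers the first and third coordinates up to sign; the middle one is invisible to the
  form.\<close>

lemma center_heisenberg:
  "center (heisenberg r) =
     {g \<in> carrier (heisenberg r). int r dvd g $$ (0, 1) \<and> int r dvd g $$ (1, 2)}"
proof -
  have "int r dvd g $$ (0, 1) \<and> int r dvd g $$ (1, 2)"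
    if "\<And>s. s \<in> carrier (heisenberg r) \<Longrightarrow> int r dvd heis_form s g" for g
  proof -
    have "int r dvd heis_form (heis_mat r 1 0 0) g" "int r dvd heis_form (heis_mat r 0 0 1) g"
      by (simp_all add: that)
    moreover have "heis_mat r 1 0 0 $$ (0, 1) = 1 mod int r" "heis_mat r 1 0 0 $$ (1, 2) = 0"
      "heis_mat r 0 0 1 $$ (0, 1) = 0" "heis_mat r 0 0 1 $$ (1, 2) = 1 mod int r"
      by simp_all
    ultimately have "int r dvd 1 mod int r * g $$ (1, 2)" "int r dvd g $$ (0, 1) * (1 mod int r)"
      by (simp_all only: heis_form_def mult_zero_left mult_zero_right diff_0 diff_0_right dvd_minus_iff)
    with one_mod_int_cases[of r] show ?thesis
      by (elim disjE) (simp_all only: mult_1_left mult_1_right one_dvd simp_thms)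
  qed
  moreover have "int r dvd heis_form s g" if "int r dvd g $$ (0, 1)" "int r dvd g $$ (1, 2)" for s g
    using that unfolding heis_form_def by (intro dvd_diff) (auto intro: dvd_mult dvd_mult2)
  ultimately show ?thesis
    unfolding center_def centralizer_heisenberg[OF order_refl] by blast
qed

lemma pseudocentralizer_heisenberg:
  assumes "S \<subseteq> carrier (heisenberg (p ^ n))"
  shows "pseudocentralizer p n S =
    {g \<in> carrier (heisenberg (p ^ n)). \<forall>s\<in>S. int p ^ (n - 1) dvd heis_form s g}"
proof -
  have d: "mat_mod (p ^ (n - 1)) (heis_mat (p ^ n) a b c) = heis_mat (p ^ (n - 1)) a b c" for a b c
    by (rule mat_mod_heis_mat) (simp add: le_imp_power_dvd)
  have "commutator (heisenberg (p ^ n)) s g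
      \<in> kernel (heisenberg (p ^ n)) (heisenberg (p ^ (n - 1))) (heis_reduce p n)
      \<longleftrightarrow> int p ^ (n - 1) dvd heis_form s g"
    if "s \<in> S" "g \<in> carrier (heisenberg (p ^ n))" for s g
  proof -
    have "commutator (heisenberg (p ^ n)) s g = heis_mat (p ^ n) 0 (heis_form s g) 0"
      using that assms by (intro commutator_heisenberg) auto
    then show ?thesis
      unfolding kernel_def heis_reduce_def mem_Collect_eq
      by (simp only: d one_heisenberg heis_mat_eq_iff cong_refl cong_0_iff of_nat_power
          heis_mat_carrier simp_thms)
  qed
  then show ?thesis
    by (auto simp: pseudocentralizer_def)
qed

text \<open>Leaves \<open>A\<close> arbitrary, as needed when an element is built from integer
  coordinates and paired with given rows.\<close>

lemma heis_form_heis_mat_right: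
  "[heis_form A (heis_mat r a b c) = A $$ (0, 1) * c - a * A $$ (1, 2)] (mod int r)"
  unfolding heis_form_def
  by (intro cong_diff cong_mult cong_refl) (simp_all add: cong_def)

section \<open>Dual bases for the commutator form\<close>

text \<open>The least \<open>v\<close> for which some value escapes \<open>q ^ Suc v\<close> works;
  the assumption bounds it by \<open>n - 1\<close>.\<close>

lemma exists_minimal_valuation:
  fixes f :: "'a \<Rightarrow> int"
  assumes "s \<in> S" "\<not> q ^ n dvd f s"
  obtains v h where "v < n" "h \<in> S" "\<And>s. s \<in> S \<Longrightarrow> q ^ v dvd f s" "\<not> q ^ Suc v dvd f h"
proof -
  define P where "P v \<longleftrightarrow> (\<exists>h\<in>S. \<not> q ^ Suc v dvd f h)" for v
  from assms have "n \<noteq> 0"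
    by (intro notI) simp
  then have n: "Suc (n - 1) = n"
    by simp
  have "P (n - 1)"
    unfolding P_def n using assms by auto
  then have "P (LEAST v. P v)" "(LEAST v. P v) \<le> n - 1"
    by (rule LeastI, rule Least_le)
  \<comment> \<open>For \<open>Suc m\<close>, minimality refutes \<open>P m\<close>, which is
    divisibility by \<open>q ^ Suc m\<close>; for \<open>0\<close> the power is
    \<open>1\<close>.\<close>
  moreover have "q ^ (LEAST v. P v) dvd f s" if "s \<in> S" for s
  proof (cases "LEAST v. P v")
    case (Suc m)
    then have "\<not> P m"
      by (intro not_less_Least) simp
    with that Suc show ?thesis
      by (auto simp: P_def)
  qed simp
  moreover obtain h where "h \<in> S" "\<not> q ^ Suc (LEAST v. P v) dvd f h"
    using calculation(1) unfolding P_def[of "Least P"] by blast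
  ultimately show thesis
    using \<open>n \<noteq> 0\<close> by (intro that[of "LEAST v. P v" h]) auto
qed

text \<open>Completes \<open>(x, z)\<close> to a matrix of determinant \<open>1\<close> modulo
  \<open>q ^ n\<close>: the gcd is a unit there, so a Bezout combination can be rescaled.\<close>

lemma exists_unimodular_complement:
  fixes x z :: int
  assumes "prime q" "\<not> (q dvd x \<and> q dvd z)"
  obtains s t where "[x * t - s * z = 1] (mod q ^ n)"
proof -
  have "\<not> q dvd gcd x z"
    using assms by auto
  then have "coprime (gcd x z) (q ^ n)"
    using assms by (meson coprime_commute coprime_power_right_iff prime_imp_coprime)
  then obtain w where w: "[gcd x z * w = 1] (mod q ^ n)"
    using cong_solve_coprime_int by blast
  obtain a b where "a * x + b * z = gcd x z"
    using bezout_int by blast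
  moreover have "x * (a * w) - (- b * w) * z = (a * x + b * z) * w"
    by (simp add: algebra_simps)
  ultimately have "x * (a * w) - (- b * w) * z = gcd x z * w"
    by (simp only:)
  with w show thesis
    by (intro that[of "a * w" "- b * w"]) simp
qed

text \<open>A row of minimal valuation is a multiple of a unimodular vector, which splits off; a second
  row is chosen so that its remaining coordinate has minimal valuation.\<close>

lemma exists_dual_basis:
  assumes p: "prime p" and S: "\<not> S \<subseteq> center (heisenberg (p ^ n))" "S \<subseteq> carrier (heisenberg (p ^ n))"
  obtains k :: nat and l d where
    "k = 1 \<or> k = 2 \<and> l 0 \<noteq> l 1"
    "\<And>i. i < k \<Longrightarrow> l i \<in> S"
    "\<And>s. s \<in> S \<Longrightarrow>
       \<exists>c. \<forall>g. [heis_form s g = (\<Sum>i<k. c i * heis_form (l i) g)] (mod int p ^ n)"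
    "\<And>i j. i < k \<Longrightarrow> j < k \<Longrightarrow>
       [heis_form (l i) (d j) = (if i = j then int p ^ (n - 1) else 0)] (mod int p ^ n)"
proof -
  define q where "q = int p"
  have q: "prime q"
    using p by (simp add: q_def)
  have form: "[heis_form A (heis_mat (p ^ n) a b c) = A $$ (0, 1) * c - a * A $$ (1, 2)] (mod q ^ n)"
    for A a b c
    using heis_form_heis_mat_right[of A "p ^ n" a b c] by (simp add: q_def)
  \<comment> \<open>The gcd of the two outer coordinates measures how far an element is from being
    central.\<close>
  obtain s0 where "s0 \<in> S" "\<not> q ^ n dvd gcd (s0 $$ (0, 1)) (s0 $$ (1, 2))"
    using S by (auto simp: center_heisenberg q_def)
  then obtain v h1 where v: "v < n" "h1 \<in> S"
    "\<And>s. s \<in> S \<Longrightarrow> q ^ v dvd gcd (s $$ (0, 1)) (s $$ (1, 2))"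
    "\<not> q ^ Suc v dvd gcd (h1 $$ (0, 1)) (h1 $$ (1, 2))"
    by (rule exists_minimal_valuation[where f = "\<lambda>s. gcd (s $$ (0, 1)) (s $$ (1, 2))"]) blast+
  have "q ^ v dvd h1 $$ (0, 1)" "q ^ v dvd h1 $$ (1, 2)"
    using v(2,3) by (auto simp del: One_nat_def)
  then obtain x z where xz: "h1 $$ (0, 1) = q ^ v * x" "h1 $$ (1, 2) = q ^ v * z"
    unfolding dvd_def by blast
  have "\<not> (q dvd x \<and> q dvd z)"
    using v(4) unfolding xz power_Suc2 by (metis gcd_greatest mult_dvd_mono dvd_refl)
  then obtain a b where ab: "[x * b - a * z = 1] (mod q ^ n)"
    using exists_unimodular_complement[OF q, of x z n] by blast
  \<comment> \<open>The determinant is kept as a symbol: the identities below hold exactly over the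
    integers, and \<open>D\<close> is then cancelled modulo \<open>q ^ n\<close>.\<close>
  define D where "D = x * b - a * z"
  \<comment> \<open>The component of \<open>s\<close> along \<open>(a, b)\<close> in the basis
    \<open>(x, z)\<close>, \<open>(a, b)\<close>, up to the factor \<open>D\<close>; it vanishes at
    \<open>h1\<close>.\<close>
  define y where "y s = x * s $$ (1, 2) - s $$ (0, 1) * z" for s
  have D: "[D * m = m] (mod q ^ n)" "[m * D = m] (mod q ^ n)" for m
    using cong_scalar_right[OF ab, of m] cong_scalar_left[OF ab, of m] by (simp_all add: D_def)
  \<comment> \<open>Cramer's rule for the row of \<open>s\<close> in the basis
    \<open>(x, z)\<close>, \<open>(a, b)\<close>. Since \<open>q ^ v\<close> divides that row, the
    coefficient of \<open>(x, z)\<close> is divisible by \<open>q ^ v\<close>, which turns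
    \<open>(x, z)\<close> into \<open>h1\<close>.\<close>
  have expand: "\<exists>\<alpha>. \<forall>g. D * heis_form s g = \<alpha> * heis_form h1 g + y s * (a * g $$ (1, 2) - g $$ (0, 1) * b)"
    if "s \<in> S" for s
  proof -
    have "q ^ v dvd s $$ (0, 1)" "q ^ v dvd s $$ (1, 2)"
      using v(3) that by (auto simp del: One_nat_def)
    then obtain X Z where XZ: "s $$ (0, 1) = q ^ v * X" "s $$ (1, 2) = q ^ v * Z"
      unfolding dvd_def by blast
    show ?thesis
      by (rule exI[of _ "X * b - a * Z"])
         (simp add: heis_form_def XZ[simplified] xz[simplified] y_def D_def algebra_simps)
  qed
  have pw: "q ^ v * q ^ (n - 1 - v) = q ^ (n - 1)"
    using v(1) by (simp flip: power_add)
  show thesis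
  proof (cases "\<forall>s\<in>S. q ^ n dvd y s")
    case True
    \<comment> \<open>All functionals are multiples of that of \<open>h1\<close>. The form pairs
      \<open>h1\<close> with \<open>(a, b)\<close> to \<open>q ^ v * D\<close>, so
      \<open>(a, b)\<close> is scaled by the missing power of \<open>q\<close>.\<close>
    show thesis
    proof (rule that[of 1 "\<lambda>_. h1" "\<lambda>_. heis_mat (p ^ n) (a * q ^ (n - 1 - v)) 0 (b * q ^ (n - 1 - v))"])
      fix s assume s: "s \<in> S"
      obtain \<alpha> where \<alpha>: "\<And>g. D * heis_form s g = \<alpha> * heis_form h1 g + y s * (a * g $$ (1, 2) - g $$ (0, 1) * b)"
        using expand[OF s] by blast
      have "[heis_form s g = \<alpha> * heis_form h1 g] (mod q ^ n)" for g
      proof -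
        have "[heis_form s g = D * heis_form s g] (mod q ^ n)"
          by (rule cong_sym[OF D(1)])
        also have "[D * heis_form s g = \<alpha> * heis_form h1 g] (mod q ^ n)"
          using True s by (simp add: \<alpha> cong_iff_dvd_diff)
        finally show ?thesis .
      qed
      then show "\<exists>c. \<forall>g. [heis_form s g = (\<Sum>i<(1::nat). c i * heis_form h1 g)] (mod int p ^ n)"
        by (intro exI[of _ "\<lambda>_. \<alpha>"]) (simp add: q_def)
    next
      have "[heis_form h1 (heis_mat (p ^ n) (a * q ^ (n - 1 - v)) 0 (b * q ^ (n - 1 - v)))
          = h1 $$ (0, 1) * (b * q ^ (n - 1 - v)) - a * q ^ (n - 1 - v) * h1 $$ (1, 2)] (mod q ^ n)"
        by (rule form)
      also have "h1 $$ (0, 1) * (b * q ^ (n - 1 - v)) - a * q ^ (n - 1 - v) * h1 $$ (1, 2)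
          = D * (q ^ v * q ^ (n - 1 - v))"
        unfolding xz D_def by (simp add: algebra_simps)
      also have "[\<dots> = q ^ (n - 1)] (mod q ^ n)"
        unfolding pw by (rule D)
      finally show "[heis_form h1 (heis_mat (p ^ n) (a * q ^ (n - 1 - v)) 0 (b * q ^ (n - 1 - v)))
          = (if i = j then int p ^ (n - 1) else 0)] (mod int p ^ n)" if "i < 1" "j < 1" for i j :: nat
        using that by (simp add: q_def)
    qed (use v in auto)
  next
    case False
    then obtain s1 where "s1 \<in> S" "\<not> q ^ n dvd y s1"
      by blast
    \<comment> \<open>Minimality makes every \<open>y s\<close> a multiple of
      \<open>y h2 = q ^ w * e\<close> modulo \<open>q ^ n\<close>, because \<open>e\<close> is prime
      to \<open>q\<close>.\<close>
    then obtain w h2 where w: "w < n" "h2 \<in> S" "\<And>s. s \<in> S \<Longrightarrow> q ^ w dvd y s" "\<not> q ^ Suc w dvd y h2"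
      by (rule exists_minimal_valuation[where f = y]) blast+
    then obtain e where e: "y h2 = q ^ w * e"
      using dvd_def by blast
    with w(4) have "\<not> q dvd e"
      unfolding power_Suc2 by (metis mult_dvd_mono dvd_refl)
    then have "coprime e (q ^ n)"
      using q by (meson coprime_commute coprime_power_right_iff prime_imp_coprime)
    then obtain e' where e': "[e * e' = 1] (mod q ^ n)"
      using cong_solve_coprime_int by blast
    obtain \<beta> where \<beta>: "\<And>g. D * heis_form h2 g = \<beta> * heis_form h1 g + y h2 * (a * g $$ (1, 2) - g $$ (0, 1) * b)"
      using expand[OF w(2)] by blast
    have pw': "q ^ w * q ^ (n - 1 - w) = q ^ (n - 1)"
      using w(1) by (simp flip: power_add)
    \<comment> \<open>The element with row \<open>S * (x, z) + T * (a, b)\<close>, where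
      \<open>S\<close> and \<open>T\<close> are integers. In these coordinates the values at
      \<open>h1\<close> and \<open>h2\<close> form a triangular system.\<close>
    define u where "u S T = heis_mat (p ^ n) (S * x + T * a) 0 (S * z + T * b)" for S T
    have u1: "[heis_form h1 (u S T) = q ^ v * T] (mod q ^ n)" for S T
    proof -
      have "[heis_form h1 (u S T) = h1 $$ (0, 1) * (S * z + T * b) - (S * x + T * a) * h1 $$ (1, 2)] (mod q ^ n)"
        unfolding u_def by (rule form)
      also have "h1 $$ (0, 1) * (S * z + T * b) - (S * x + T * a) * h1 $$ (1, 2) = D * (q ^ v * T)"
        unfolding xz D_def by (simp add: algebra_simps)
      also have "[\<dots> = q ^ v * T] (mod q ^ n)"
        by (rule D)
      finally show ?thesis .
    qed
    have u2: "[heis_form h2 (u S T) = \<beta> * (q ^ v * T) - q ^ w * e * S] (mod q ^ n)" for S T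
    proof -
      have "[a * u S T $$ (1, 2) - u S T $$ (0, 1) * b = a * (S * z + T * b) - (S * x + T * a) * b] (mod q ^ n)"
        by (intro cong_diff cong_mult cong_refl) (simp_all add: u_def q_def cong_def)
      also have "a * (S * z + T * b) - (S * x + T * a) * b = D * (- S)"
        by (simp add: D_def algebra_simps)
      also have "[\<dots> = - S] (mod q ^ n)"
        by (rule D)
      finally have 1: "[a * u S T $$ (1, 2) - u S T $$ (0, 1) * b = - S] (mod q ^ n)" .
      have "[heis_form h2 (u S T) = D * heis_form h2 (u S T)] (mod q ^ n)"
        by (rule cong_sym[OF D(1)])
      also have "[D * heis_form h2 (u S T) = \<beta> * (q ^ v * T) + q ^ w * e * (- S)] (mod q ^ n)"
        unfolding \<beta> e by (intro cong_add cong_mult cong_refl u1 1)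
      finally show ?thesis by simp
    qed
    \<comment> \<open>Distinctness later rules out \<open>k = 2\<close> for a singleton.\<close>
    have neq: "h1 \<noteq> h2"
    proof
      assume "h1 = h2"
      moreover have "y h1 = 0"
        unfolding y_def xz by simp
      ultimately show False
        using w(4) by simp
    qed
    \<comment> \<open>The witnesses solve \<open>q ^ v * T = A\<close> and
      \<open>\<beta> * q ^ v * T - q ^ w * e * S = B\<close> with \<open>(A, B)\<close> equal to
      \<open>(q ^ (n - 1), 0)\<close> and \<open>(0, q ^ (n - 1))\<close>, where \<open>e'\<close>
      inverts \<open>e\<close>.\<close>
    show thesis
    proof (rule that[of 2 "\<lambda>i. if i = 0 then h1 else h2"
          "\<lambda>i. if i = 0 then u (\<beta> * e' * q ^ (n - 1 - w)) (q ^ (n - 1 - v)) else u (- e' * q ^ (n - 1 - w)) 0"])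
      fix s assume s: "s \<in> S"
      obtain \<alpha> where \<alpha>: "\<And>g. D * heis_form s g = \<alpha> * heis_form h1 g + y s * (a * g $$ (1, 2) - g $$ (0, 1) * b)"
        using expand[OF s] by blast
      obtain f where f: "y s = q ^ w * f"
        using w(3)[OF s] dvd_def by blast
      \<comment> \<open>Replace \<open>y s\<close> by \<open>f * e' * y h2\<close> and eliminate the
        \<open>(a, b)\<close> term by means of the expansion of \<open>h2\<close>.\<close>
      have "[heis_form s g = (\<alpha> - f * e' * \<beta>) * heis_form h1 g + f * e' * heis_form h2 g] (mod q ^ n)" for g
      proof -
        define W where "W = a * g $$ (1, 2) - g $$ (0, 1) * b"
        have "[heis_form s g = D * heis_form s g] (mod q ^ n)"
          by (rule cong_sym[OF D(1)])
        also have "D * heis_form s g = \<alpha> * heis_form h1 g + f * q ^ w * W * 1"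
          by (simp add: \<alpha> f W_def)
        also have "[\<dots> = \<alpha> * heis_form h1 g + f * q ^ w * W * (e * e')] (mod q ^ n)"
          by (intro cong_add cong_mult cong_refl cong_sym[OF e'])
        also have "\<alpha> * heis_form h1 g + f * q ^ w * W * (e * e')
            = (\<alpha> - f * e' * \<beta>) * heis_form h1 g + f * e' * (D * heis_form h2 g)"
          unfolding \<beta> e W_def[symmetric] by (simp add: algebra_simps)
        also have "[\<dots> = (\<alpha> - f * e' * \<beta>) * heis_form h1 g + f * e' * heis_form h2 g] (mod q ^ n)"
          by (intro cong_add cong_mult cong_refl D)
        finally show ?thesis .
      qed
      then show "\<exists>c. \<forall>g. [heis_form s g = (\<Sum>i<(2::nat). c i * heis_form (if i = 0 then h1 else h2) g)] (mod int p ^ n)"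
        by (intro exI[of _ "\<lambda>i. if i = 0 then \<alpha> - f * e' * \<beta> else f * e'"])
           (simp add: q_def numeral_2_eq_2)
    next
      fix i j :: nat assume ij: "i < 2" "j < 2"
      have "[heis_form h1 (u (\<beta> * e' * q ^ (n - 1 - w)) (q ^ (n - 1 - v))) = q ^ (n - 1)] (mod q ^ n)"
        using u1[of "\<beta> * e' * q ^ (n - 1 - w)" "q ^ (n - 1 - v)"] unfolding pw .
      moreover have "[heis_form h1 (u (- e' * q ^ (n - 1 - w)) 0) = 0] (mod q ^ n)"
        using u1[of "- e' * q ^ (n - 1 - w)" 0] by simp
      moreover have "[heis_form h2 (u (\<beta> * e' * q ^ (n - 1 - w)) (q ^ (n - 1 - v))) = 0] (mod q ^ n)"
      proof -
        have "[heis_form h2 (u (\<beta> * e' * q ^ (n - 1 - w)) (q ^ (n - 1 - v)))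
           = \<beta> * (q ^ v * q ^ (n - 1 - v)) - q ^ w * e * (\<beta> * e' * q ^ (n - 1 - w))] (mod q ^ n)"
          by (rule u2)
        also have "\<beta> * (q ^ v * q ^ (n - 1 - v)) - q ^ w * e * (\<beta> * e' * q ^ (n - 1 - w))
            = \<beta> * q ^ (n - 1) - (e * e') * (\<beta> * q ^ (n - 1))"
          unfolding pw pw'[symmetric] by (simp add: algebra_simps)
        also have "[\<dots> = \<beta> * q ^ (n - 1) - 1 * (\<beta> * q ^ (n - 1))] (mod q ^ n)"
          by (intro cong_diff cong_mult cong_refl e')
        finally show ?thesis by simp
      qed
      moreover have "[heis_form h2 (u (- e' * q ^ (n - 1 - w)) 0) = q ^ (n - 1)] (mod q ^ n)"
      proof -
        have "[heis_form h2 (u (- e' * q ^ (n - 1 - w)) 0)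
           = \<beta> * (q ^ v * 0) - q ^ w * e * (- e' * q ^ (n - 1 - w))] (mod q ^ n)"
          by (rule u2)
        also have "\<beta> * (q ^ v * 0) - q ^ w * e * (- e' * q ^ (n - 1 - w)) = (e * e') * q ^ (n - 1)"
          unfolding pw'[symmetric] by (simp add: algebra_simps)
        also have "[\<dots> = 1 * q ^ (n - 1)] (mod q ^ n)"
          by (intro cong_mult cong_refl e')
        finally show ?thesis by simp
      qed
      ultimately show "[heis_form (if i = 0 then h1 else h2)
          (if j = 0 then u (\<beta> * e' * q ^ (n - 1 - w)) (q ^ (n - 1 - v)) else u (- e' * q ^ (n - 1 - w)) 0)
          = (if i = j then int p ^ (n - 1) else 0)] (mod int p ^ n)"
        using ij by (auto simp: q_def less_2_cases_iff)
    qed (use v w neq in \<open>auto simp: u_def\<close>)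
  qed
qed

section \<open>The quotients \<open>P(S)/C(S)\<close>\<close>

text \<open>An intersection of kernels of homomorphisms into the residues modulo \<open>m\<close>.
  Taking \<open>m = p ^ (n - 1)\<close> gives \<open>P(S)\<close>, taking \<open>m = p ^ n\<close>
  gives \<open>C(S)\<close>.\<close>

lemma normal_heis_form_dvd:
  assumes "S \<subseteq> carrier (heisenberg r)" "m dvd int r"
  shows "{g \<in> carrier (heisenberg r). \<forall>s\<in>S. m dvd heis_form s g} \<lhd> heisenberg r" (is "?N \<lhd> ?G")
proof -
  interpret G: group ?G
    by (rule group_heisenberg)
  have mult: "m dvd heis_form s (a \<otimes>\<^bsub>?G\<^esub> b) \<longleftrightarrow> m dvd heis_form s a + heis_form s b"
    if "s \<in> S" "a \<in> carrier ?G" "b \<in> carrier ?G" for s a b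
    using cong_dvd_iff cong_dvd_modulus[OF heis_form_mult_right assms(2)] assms(1) that by blast
  have one: "m dvd heis_form s \<one>\<^bsub>?G\<^esub>" for s
  proof -
    have "[heis_form s \<one>\<^bsub>?G\<^esub> = 0] (mod int r)"
      using heis_form_heis_mat_right[of s r 0 0 0] by (simp add: one_heisenberg)
    then show ?thesis
      using assms(2) by (meson cong_0_iff dvd_trans)
  qed
  have inv: "m dvd heis_form s (inv\<^bsub>?G\<^esub> a) + heis_form s a" if "s \<in> S" "a \<in> carrier ?G" for s a
    using mult[of s "inv\<^bsub>?G\<^esub> a" a] that one by simp
  have inv': "m dvd heis_form s (inv\<^bsub>?G\<^esub> a) \<longleftrightarrow> m dvd heis_form s a" if "s \<in> S" "a \<in> carrier ?G" for s a
    using inv[OF that] by (metis dvd_add_left_iff dvd_add_right_iff)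
  have sub: "subgroup ?N ?G"
  proof (rule G.subgroupI)
    have "\<one>\<^bsub>?G\<^esub> \<in> ?N"
      using one by simp
    then show "?N \<noteq> {}"
      by blast
  qed (auto simp: inv' mult)
  show ?thesis
    unfolding G.normal_inv_iff
  proof (intro conjI sub ballI CollectI)
    fix x h s assume x: "x \<in> carrier ?G" and h: "h \<in> ?N" and s: "s \<in> S"
    have "m dvd heis_form s (x \<otimes>\<^bsub>?G\<^esub> h \<otimes>\<^bsub>?G\<^esub> inv\<^bsub>?G\<^esub> x) \<longleftrightarrow>
          m dvd heis_form s (x \<otimes>\<^bsub>?G\<^esub> h) + heis_form s (inv\<^bsub>?G\<^esub> x)"
      using x h s by (intro mult) auto
    moreover have "[heis_form s (x \<otimes>\<^bsub>?G\<^esub> h) = heis_form s x + heis_form s h] (mod m)"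
      using x h s assms by (intro cong_dvd_modulus[OF heis_form_mult_right assms(2)]) auto
    \<comment> \<open>Regrouped so that the values at \<open>x\<close> and its inverse cancel modulo
      \<open>m\<close>.\<close>
    then have "[heis_form s (x \<otimes>\<^bsub>?G\<^esub> h) + heis_form s (inv\<^bsub>?G\<^esub> x)
        = (heis_form s (inv\<^bsub>?G\<^esub> x) + heis_form s x) + heis_form s h] (mod m)"
      by (metis add.assoc add.commute cong_add_rcancel)
    moreover have "m dvd (heis_form s (inv\<^bsub>?G\<^esub> x) + heis_form s x) + heis_form s h"
      using h s by (intro dvd_add[OF inv[OF s x]]) auto
    ultimately show "m dvd heis_form s (x \<otimes>\<^bsub>?G\<^esub> h \<otimes>\<^bsub>?G\<^esub> inv\<^bsub>?G\<^esub> x)"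
      using cong_dvd_iff by blast
  qed auto
qed

lemma normal_centralizer_heisenberg:
  assumes "S \<subseteq> carrier (heisenberg r)"
  shows "centralizer (heisenberg r) S \<lhd> heisenberg r"
  unfolding centralizer_heisenberg[OF assms] using assms by (rule normal_heis_form_dvd) simp

lemma subgroup_pseudocentralizer:
  assumes "S \<subseteq> carrier (heisenberg (p ^ n))"
  shows "subgroup (pseudocentralizer p n S) (heisenberg (p ^ n))"
  unfolding pseudocentralizer_heisenberg[OF assms]
  by (rule normal_imp_subgroup[OF normal_heis_form_dvd[OF assms]]) (simp add: le_imp_power_dvd)

lemma centralizer_subset_pseudocentralizer:
  assumes "S \<subseteq> carrier (heisenberg (p ^ n))"
  shows "centralizer (heisenberg (p ^ n)) S \<subseteq> pseudocentralizer p n S"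
proof -
  have "int p ^ (n - 1) dvd int (p ^ n)"
    by (simp add: le_imp_power_dvd)
  then show ?thesis
    unfolding pseudocentralizer_heisenberg[OF assms] centralizer_heisenberg[OF assms]
    by (auto intro: dvd_trans)
qed

section \<open>\<open>P(S)/C(S)\<close> as a factor group\<close>

lemma group_pseudocentralizer_group:
  assumes "S \<subseteq> carrier (heisenberg (p ^ n))"
  shows "group (pseudocentralizer_group p n S)"
  unfolding pseudocentralizer_group_def
  by (rule subgroup.subgroup_is_group[OF subgroup_pseudocentralizer[OF assms] group_heisenberg])

lemma normal_centralizer_pseudocentralizer:
  assumes "S \<subseteq> carrier (heisenberg (p ^ n))"
  shows "centralizer (heisenberg (p ^ n)) S \<lhd> pseudocentralizer_group p n S"
  unfolding pseudocentralizer_group_def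
  by (intro group.normal_restrict_supergroup group_heisenberg subgroup_pseudocentralizer
      normal_centralizer_heisenberg centralizer_subset_pseudocentralizer assms)

lemma group_pc_quotient:
  assumes "S \<subseteq> carrier (heisenberg (p ^ n))"
  shows "group (pc_quotient p n S)"
  unfolding pc_quotient_def
  by (rule normal.factorgroup_is_group[OF normal_centralizer_pseudocentralizer[OF assms]])

text \<open>Cosets are taken in the full Heisenberg group, so that those for different
  \<open>S\<close> can be compared and multiplied in one place.\<close>

lemma carrier_pc_quotient:
  "carrier (pc_quotient p n S) =
     (\<lambda>x. centralizer (heisenberg (p ^ n)) S #>\<^bsub>heisenberg (p ^ n)\<^esub> x) ` pseudocentralizer p n S"
  by (simp add: pc_quotient_def carrier_FactGroup pseudocentralizer_group_def r_coset_def)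

lemma mult_pc_quotient:
  "A \<otimes>\<^bsub>pc_quotient p n S\<^esub> B = A <#>\<^bsub>heisenberg (p ^ n)\<^esub> B"
  by (simp add: pc_quotient_def pseudocentralizer_group_def set_mult_def)

text \<open>Makes the digit \<open>a div m mod q\<close> well defined on residue classes modulo
  \<open>m * q\<close>.\<close>

lemma div_mod_cong_int:
  fixes a b m q :: int
  assumes "[a = b] (mod m * q)" "m > 0" "q > 0"
  shows "a div m mod q = b div m mod q"
proof -
  have "(x mod (m * q)) div m = x div m mod q" for x
    using assms by (simp add: zmod_zmult2_eq)
  then show ?thesis
    using assms(1) by (metis cong_def)
qed

text \<open>The first isomorphism theorem: \<open>span\<close> identifies the kernel with
  \<open>C(S)\<close>, and \<open>dual\<close> gives surjectivity.\<close>

lemma pc_quotient_iso_cyclic_power: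
  fixes k :: nat and l d :: "nat \<Rightarrow> int mat"
  assumes p: "prime p" and n: "n \<ge> 1" and S: "S \<subseteq> carrier (heisenberg (p ^ n))"
    and l: "\<And>i. i < k \<Longrightarrow> l i \<in> S"
    and span: "\<And>s. s \<in> S \<Longrightarrow>
       \<exists>c. \<forall>g. [heis_form s g = (\<Sum>i<k. c i * heis_form (l i) g)] (mod int p ^ n)"
    and dual: "\<And>i j. i < k \<Longrightarrow> j < k \<Longrightarrow>
       [heis_form (l i) (d j) = (if i = j then int p ^ (n - 1) else 0)] (mod int p ^ n)"
  shows "pc_quotient p n S \<cong> cyclic_power p k"
proof -
  define q M where "q = int p" and "M = q ^ (n - 1)"
  have pos: "q > 0" "M > 0"
    using p by (simp_all add: q_def M_def prime_gt_0_nat)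
  have qn: "q ^ n = M * q" "int p ^ n = M * q" "int (p ^ n) = M * q" "int p ^ (n - 1) = M"
    using n by (simp_all add: q_def M_def flip: power_Suc2)
  let ?G = "heisenberg (p ^ n)" and ?P = "pseudocentralizer_group p n S"
  define f where "f x = (\<lambda>i\<in>{..<k}. heis_form (l i) x div M mod q)" for x
  have P: "carrier ?P = {g \<in> carrier ?G. \<forall>s\<in>S. M dvd heis_form s g}"
    by (simp add: pseudocentralizer_group_def pseudocentralizer_heisenberg[OF S] q_def M_def)
  have hom: "f \<in> hom ?P (cyclic_power p k)"
  proof (rule homI)
    fix x assume "x \<in> carrier ?P"
    show "f x \<in> carrier (cyclic_power p k)"
      using pos by (auto simp: f_def cyclic_power_def carrier_integer_mod_group q_def)
  next
    fix x y assume xy: "x \<in> carrier ?P" "y \<in> carrier ?P"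
    have "heis_form (l i) (x \<otimes>\<^bsub>?G\<^esub> y) div M mod q =
        (heis_form (l i) x div M mod q + heis_form (l i) y div M mod q) mod q" if "i < k" for i
    proof -
      have "[heis_form (l i) (x \<otimes>\<^bsub>?G\<^esub> y) = heis_form (l i) x + heis_form (l i) y] (mod M * q)"
        unfolding qn(3)[symmetric] using xy l[OF that] S by (intro heis_form_mult_right) (auto simp: P)
      then have "heis_form (l i) (x \<otimes>\<^bsub>?G\<^esub> y) div M mod q = (heis_form (l i) x + heis_form (l i) y) div M mod q"
        using pos by (intro div_mod_cong_int)
      \<comment> \<open>Division by \<open>M\<close> is additive here since \<open>M\<close> divides
        the values of the form on \<open>P(S)\<close>.\<close>
      also have "(heis_form (l i) x + heis_form (l i) y) div M = heis_form (l i) x div M + heis_form (l i) y div M"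
        using xy l[OF that] by (intro div_plus_div_distrib_dvd_left) (auto simp: P)
      finally show ?thesis
        by (simp add: mod_add_eq)
    qed
    then show "f (x \<otimes>\<^bsub>?P\<^esub> y) = f x \<otimes>\<^bsub>cyclic_power p k\<^esub> f y"
      by (auto simp: f_def cyclic_power_def pseudocentralizer_group_def fun_eq_iff q_def)
  qed
  interpret group_hom ?P "cyclic_power p k" f
    using hom group_pseudocentralizer_group[OF S]
    by (simp add: group_hom_def group_hom_axioms_def cyclic_power_def)
  have C: "centralizer ?G S = {g \<in> carrier ?G. \<forall>s\<in>S. M * q dvd heis_form s g}"
    by (simp only: centralizer_heisenberg[OF S] qn)
  have f_one: "f g = \<one>\<^bsub>cyclic_power p k\<^esub> \<longleftrightarrow> (\<forall>i<k. M * q dvd heis_form (l i) g)" if g: "g \<in> carrier ?P" for g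
  proof -
    have "heis_form (l i) g div M mod q = 0 \<longleftrightarrow> M * q dvd heis_form (l i) g" if "i < k" for i
    proof -
      have "M dvd heis_form (l i) g"
        using g l[OF that] by (simp add: P)
      then obtain m where "heis_form (l i) g = M * m" ..
      then show ?thesis
        using pos by (simp add: mod_eq_0_iff_dvd)
    qed
    then show ?thesis
      by (auto simp: f_def cyclic_power_def fun_eq_iff)
  qed
  have kernel: "kernel ?P (cyclic_power p k) f = centralizer ?G S"
  proof (intro equalityI subsetI)
    fix g assume "g \<in> kernel ?P (cyclic_power p k) f"
    then have g: "g \<in> carrier ?P" "\<And>i. i < k \<Longrightarrow> M * q dvd heis_form (l i) g"
      using f_one by (auto simp: kernel_def)
    have "M * q dvd heis_form s g" if s: "s \<in> S" for s
    proof -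
      obtain c where "[heis_form s g = (\<Sum>i<k. c i * heis_form (l i) g)] (mod M * q)"
        using span[OF s] unfolding qn by blast
      moreover have "M * q dvd (\<Sum>i<k. c i * heis_form (l i) g)"
        using g by (intro dvd_sum dvd_mult) auto
      ultimately show ?thesis
        using cong_dvd_iff by blast
    qed
    then show "g \<in> centralizer ?G S"
      using g(1) by (simp add: C P)
  next
    fix g assume g: "g \<in> centralizer ?G S"
    then have "g \<in> carrier ?P"
      using centralizer_subset_pseudocentralizer[OF S] by (auto simp: pseudocentralizer_group_def)
    then show "g \<in> kernel ?P (cyclic_power p k) f"
      using g l f_one by (auto simp: kernel_def C)
  qed
  have "f ` carrier ?P = carrier (cyclic_power p k)"
  proof (intro equalityI subsetI)
    fix y assume y: "y \<in> carrier (cyclic_power p k)"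
    \<comment> \<open>The combination of the \<open>d j\<close> with coefficients
      \<open>y j\<close>, formed in the two coordinates that the form reads.\<close>
    define g where "g = heis_mat (p ^ n) (\<Sum>j<k. y j * d j $$ (0, 1)) 0 (\<Sum>j<k. y j * d j $$ (1, 2))"
    have form: "[heis_form (l i) g = y i * M] (mod M * q)" if "i < k" for i
    proof -
      have "[heis_form (l i) g = l i $$ (0, 1) * (\<Sum>j<k. y j * d j $$ (1, 2))
          - (\<Sum>j<k. y j * d j $$ (0, 1)) * l i $$ (1, 2)] (mod M * q)"
        unfolding g_def qn(3)[symmetric] by (rule heis_form_heis_mat_right)
      also have "l i $$ (0, 1) * (\<Sum>j<k. y j * d j $$ (1, 2)) - (\<Sum>j<k. y j * d j $$ (0, 1)) * l i $$ (1, 2)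
          = (\<Sum>j<k. y j * heis_form (l i) (d j))"
        unfolding heis_form_def sum_distrib_left sum_distrib_right sum_subtractf[symmetric]
        by (intro sum.cong) (simp_all add: algebra_simps)
      also have "[\<dots> = (\<Sum>j<k. y j * (if i = j then M else 0))] (mod M * q)"
        using dual that unfolding qn by (intro cong_sum cong_mult cong_refl) auto
      also have "(\<Sum>j<k. y j * (if i = j then M else 0)) = y i * M"
        using that by (simp add: if_distrib sum.delta cong: if_cong)
      finally show ?thesis .
    qed
    \<comment> \<open>Membership in \<open>P(S)\<close> concerns all of \<open>S\<close>;
      \<open>span\<close> reduces it to the rows \<open>l i\<close>, where the value is
      \<open>y i * M\<close>.\<close>
    have "M dvd heis_form s g" if s: "s \<in> S" for s
    proof -
      have dvd: "M dvd heis_form (l i) g" if "i < k" for i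
        using form[OF that] cong_dvd_modulus cong_dvd_iff dvd_triv_left dvd_triv_right by metis
      obtain c where "[heis_form s g = (\<Sum>i<k. c i * heis_form (l i) g)] (mod M * q)"
        using span[OF s] unfolding qn by blast
      then have "[heis_form s g = (\<Sum>i<k. c i * heis_form (l i) g)] (mod M)"
        by (rule cong_dvd_modulus) simp
      moreover have "M dvd (\<Sum>i<k. c i * heis_form (l i) g)"
        using dvd by (intro dvd_sum dvd_mult) auto
      ultimately show ?thesis
        using cong_dvd_iff by blast
    qed
    then have "g \<in> carrier ?P"
      by (simp add: P g_def)
    moreover have "f g = y"
    proof
      fix i
      show "f g i = y i"
      proof (cases "i < k")
        case True
        have "heis_form (l i) g div M mod q = y i * M div M mod q"
          using form[OF True] pos by (intro div_mod_cong_int)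
        also have "\<dots> = y i"
          using pos y True
          by (auto simp: cyclic_power_def carrier_integer_mod_group q_def PiE_iff split: if_splits)
        finally show ?thesis
          using True by (simp add: f_def)
      qed (use y in \<open>auto simp: f_def cyclic_power_def PiE_iff extensional_def\<close>)
    qed
    ultimately show "y \<in> f ` carrier ?P"
      by blast
  qed (use hom_closed in auto)
  then show ?thesis
    using FactGroup_iso unfolding kernel pc_quotient_def by blast
qed

text \<open>The clause on singletons serves the factors \<open>P(h)/C(h)\<close>: two distinct rows
  cannot come from \<open>{h}\<close>, so there \<open>k = 1\<close>.\<close>

lemma pc_quotient_structure:
  assumes "prime p" "n \<ge> 1" "S \<subseteq> carrier (heisenberg (p ^ n))" "\<not> S \<subseteq> center (heisenberg (p ^ n))"
  obtains k :: nat where "k = 1 \<or> k = 2 \<and> (\<nexists>h. S = {h})" "pc_quotient p n S \<cong> cyclic_power p k"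
proof (rule exists_dual_basis[OF assms(1,4,3)])
  fix k :: nat and l d
  assume *: "k = 1 \<or> k = 2 \<and> l 0 \<noteq> l 1"
    "\<And>i. i < k \<Longrightarrow> l i \<in> S"
    "\<And>s. s \<in> S \<Longrightarrow>
       \<exists>c. \<forall>g. [heis_form s g = (\<Sum>i<k. c i * heis_form (l i) g)] (mod int p ^ n)"
    "\<And>i j. i < k \<Longrightarrow> j < k \<Longrightarrow>
       [heis_form (l i) (d j) = (if i = j then int p ^ (n - 1) else 0)] (mod int p ^ n)"
  have "pc_quotient p n S \<cong> cyclic_power p k"
    using assms(1-3) *(2-4) by (rule pc_quotient_iso_cyclic_power)
  moreover have "k = 1 \<or> k = 2 \<and> (\<nexists>h. S = {h})"
    using *(1) *(2)[of 0] *(2)[of 1] by auto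
  ultimately show thesis
    by (rule that[rotated])
qed

section \<open>Products of cyclic groups\<close>

lemma product_group_reindex:
  assumes "bij_betw \<beta> J I"
  shows "product_group I G \<cong> product_group J (\<lambda>j. G (\<beta> j))"
proof -
  have \<beta>: "\<beta> j \<in> I" if "j \<in> J" for j
    using assms that by (auto simp: bij_betw_def)
  \<comment> \<open>Precomposition with the bijection; surjectivity uses precomposition with
    \<open>inv_into J \<beta>\<close>.\<close>
  have "(\<lambda>x. \<lambda>j\<in>J. x (\<beta> j)) \<in> iso (product_group I G) (product_group J (\<lambda>j. G (\<beta> j)))"
    unfolding iso_iff
  proof (intro conjI)
    show "(\<lambda>x. \<lambda>j\<in>J. x (\<beta> j)) \<in> hom (product_group I G) (product_group J (\<lambda>j. G (\<beta> j)))"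
      by (intro homI) (auto simp: \<beta> fun_eq_iff PiE_iff)
    show "inj_on (\<lambda>x. \<lambda>j\<in>J. x (\<beta> j)) (carrier (product_group I G))"
    proof (intro inj_onI)
      fix x y assume xy: "x \<in> carrier (product_group I G)" "y \<in> carrier (product_group I G)"
        and eq: "(\<lambda>j\<in>J. x (\<beta> j)) = (\<lambda>j\<in>J. y (\<beta> j))"
      have "x i = y i" if "i \<in> I" for i
        using eq that assms unfolding bij_betw_def by (metis imageE restrict_apply')
      then show "x = y"
        using xy by (auto intro: PiE_ext)
    qed
    show "(\<lambda>x. \<lambda>j\<in>J. x (\<beta> j)) ` carrier (product_group I G) = carrier (product_group J (\<lambda>j. G (\<beta> j)))"
    proof (intro equalityI subsetI)
      fix y assume y: "y \<in> carrier (product_group J (\<lambda>j. G (\<beta> j)))"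
      have inv: "inv_into J \<beta> i \<in> J" "\<beta> (inv_into J \<beta> i) = i" if "i \<in> I" for i
        using assms that by (auto simp: bij_betw_def inv_into_into f_inv_into_f)
      have "inv_into J \<beta> (\<beta> j) = j" if "j \<in> J" for j
        using assms that by (simp add: bij_betw_def)
      then have "(\<lambda>j\<in>J. (\<lambda>i\<in>I. y (inv_into J \<beta> i)) (\<beta> j)) = y"
        using y by (auto simp: fun_eq_iff \<beta> PiE_iff extensional_def)
      moreover have "(\<lambda>i\<in>I. y (inv_into J \<beta> i)) \<in> carrier (product_group I G)"
        using y inv by (fastforce simp: PiE_iff)
      ultimately show "y \<in> (\<lambda>x. \<lambda>j\<in>J. x (\<beta> j)) ` carrier (product_group I G)"
        by (intro image_eqI[where x = "\<lambda>i\<in>I. y (inv_into J \<beta> i)"]) simp_all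
    qed (auto simp: \<beta> PiE_iff)
  qed
  then show ?thesis
    by (rule is_isoI)
qed

lemma cyclic_power_1_iso: "cyclic_power p 1 \<cong> integer_mod_group p"
proof (rule is_isoI)
  show "(\<lambda>x. x 0) \<in> iso (cyclic_power p 1) (integer_mod_group p)"
    unfolding iso_iff
  proof (intro conjI)
    show "(\<lambda>x. x 0) ` carrier (cyclic_power p 1) = carrier (integer_mod_group p)"
    proof (intro equalityI subsetI)
      fix y assume "y \<in> carrier (integer_mod_group p)"
      then show "y \<in> (\<lambda>x. x 0) ` carrier (cyclic_power p 1)"
        by (intro image_eqI[where x = "\<lambda>i\<in>{..<1}. y"]) (auto simp: cyclic_power_def)
    qed (auto simp: cyclic_power_def)
    show "inj_on (\<lambda>x. x 0) (carrier (cyclic_power p 1))"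
    proof (rule inj_onI)
      fix x y assume "x \<in> carrier (cyclic_power p 1)" "y \<in> carrier (cyclic_power p 1)" "x 0 = y 0"
      then show "x = y"
        unfolding cyclic_power_def carrier_product_group by (elim PiE_ext) auto
    qed
    show "(\<lambda>x. x 0) \<in> hom (cyclic_power p 1) (integer_mod_group p)"
      by (rule homI) (simp_all add: cyclic_power_def PiE_iff)
  qed
qed

lemma centralizer_subset_centralizer_singleton:
  "h \<in> H \<Longrightarrow> centralizer G H \<subseteq> centralizer G {h}"
  by (auto simp: centralizer_def)

text \<open>Used as \<open>C(h) C(H) = C(h)\<close>, which sends the coset \<open>C(H) x\<close> to
  \<open>C(h) x\<close>.\<close>

lemma (in group) subgroup_mult_subset_eq:
  assumes "subgroup A G" "subgroup B G" "B \<subseteq> A"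
  shows "A <#> B = A"
proof (intro equalityI subsetI)
  fix a assume "a \<in> A"
  then have "a = a \<otimes> \<one>" "\<one> \<in> B"
    using assms subgroup.mem_carrier subgroup.one_closed by fastforce+
  with \<open>a \<in> A\<close> show "a \<in> A <#> B"
    unfolding set_mult_def by blast
next
  fix x assume "x \<in> A <#> B"
  then show "x \<in> A"
    using assms by (auto simp: set_mult_def intro: subgroup.m_closed)
qed

section \<open>The diagonal map into the product of the \<open>P(h)/C(h)\<close>\<close>

theorem lemma5p13:
  fixes p n :: nat and H Hd :: "int mat set"
  assumes "prime p" and "n \<ge> 1"
    and "subgroup H (heisenberg (p ^ n))"
    and "\<not> H \<subseteq> center (heisenberg (p ^ n))"
    and "Hd = H - center (heisenberg (p ^ n))"
  shows "(\<lambda>x. \<lambda>h\<in>Hd. x) \<in> hom (pseudocentralizer_group p n H)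
                             (product_group Hd (\<lambda>h. pseudocentralizer_group p n {h}))
    \<and> product_group Hd (\<lambda>h. pc_quotient p n {h}) \<cong> cyclic_power p (card Hd)
    \<and> (\<exists>\<phi>. \<phi> \<in> hom (pc_quotient p n H) (product_group Hd (\<lambda>h. pc_quotient p n {h}))
         \<and> (\<forall>x\<in>pseudocentralizer p n H.
              \<phi> (centralizer (heisenberg (p ^ n)) H #>\<^bsub>heisenberg (p ^ n)\<^esub> x)
              = (\<lambda>h\<in>Hd. centralizer (heisenberg (p ^ n)) {h} #>\<^bsub>heisenberg (p ^ n)\<^esub> x))
         \<and> \<phi> \<in> iso (pc_quotient p n H)
                ((product_group Hd (\<lambda>h. pc_quotient p n {h}))
                   \<lparr>carrier := \<phi> ` carrier (pc_quotient p n H)\<rparr>)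
         \<and> (\<exists>k\<in>{1, 2}.
              (product_group Hd (\<lambda>h. pc_quotient p n {h}))
                \<lparr>carrier := \<phi> ` carrier (pc_quotient p n H)\<rparr> \<cong> cyclic_power p k
              \<and> pc_quotient p n H \<cong> cyclic_power p k))"
proof -
  let ?G = "heisenberg (p ^ n)" and ?Q = "pc_quotient p n H"
  let ?R = "product_group Hd (\<lambda>h. pc_quotient p n {h})"
  let ?C = "centralizer (heisenberg (p ^ n))"
  interpret G: group ?G
    by (rule group_heisenberg)
  have H: "H \<subseteq> carrier ?G"
    using assms(3) by (rule subgroup.subset)
  have Hd: "{h} \<subseteq> carrier ?G" "h \<in> H" "\<not> {h} \<subseteq> center ?G" if "h \<in> Hd" for h
    using that H assms(5) by auto
  have P_sub: "pseudocentralizer p n H \<subseteq> pseudocentralizer p n {h}" if "h \<in> Hd" for h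
    using Hd[OF that] by (auto simp: pseudocentralizer_def)
  have P_carrier: "x \<in> carrier ?G" if "x \<in> pseudocentralizer p n H" for x
    using that by (simp add: pseudocentralizer_def)

  have hom_diag: "(\<lambda>x. \<lambda>h\<in>Hd. x) \<in> hom (pseudocentralizer_group p n H)
      (product_group Hd (\<lambda>h. pseudocentralizer_group p n {h}))"
    using P_sub by (intro homI) (auto simp: pseudocentralizer_group_def fun_eq_iff)

  have prod: "?R \<cong> cyclic_power p (card Hd)"
  proof -
    have "finite Hd"
      using assms(1,5) H finite_heisenberg[of "p ^ n"] by (auto intro: finite_subset simp: prime_gt_0_nat)
    then obtain \<beta> where "bij_betw \<beta> {..<card Hd} Hd"
      using ex_bij_betw_nat_finite[of Hd] by (auto simp: lessThan_atLeast0)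
    then have "product_group Hd (\<lambda>_. integer_mod_group p) \<cong> cyclic_power p (card Hd)"
      unfolding cyclic_power_def by (rule product_group_reindex)
    moreover have "?R \<cong> product_group Hd (\<lambda>_. integer_mod_group p)"
    proof (rule iso_product_groupI)
      fix h assume h: "h \<in> Hd"
      show "group (pc_quotient p n {h})"
        using Hd[OF h] by (intro group_pc_quotient)
      obtain k where "k = 1 \<or> k = 2 \<and> (\<nexists>h'. {h} = {h'})" "pc_quotient p n {h} \<cong> cyclic_power p k"
        using Hd(1,3)[OF h] pc_quotient_structure assms(1,2) by metis
      then show "pc_quotient p n {h} \<cong> integer_mod_group p"
        using cyclic_power_1_iso iso_trans by blast
    qed simp
    ultimately show ?thesis
      using iso_trans by blast
  qed

  \<comment> \<open>Multiplying the whole coset by \<open>C(h)\<close> avoids a choice of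
    representative, so well-definedness is automatic.\<close>
  define \<phi> where "\<phi> K = (\<lambda>h\<in>Hd. ?C {h} <#>\<^bsub>?G\<^esub> K)" for K
  have C_sub: "subgroup (?C H) ?G" "\<And>h. h \<in> Hd \<Longrightarrow> subgroup (?C {h}) ?G"
    by (intro normal_imp_subgroup normal_centralizer_heisenberg H Hd(1); assumption)+
  have \<phi>: "\<phi> (?C H #>\<^bsub>?G\<^esub> x) = (\<lambda>h\<in>Hd. ?C {h} #>\<^bsub>?G\<^esub> x)" if "x \<in> carrier ?G" for x
    unfolding \<phi>_def
  proof (rule restrict_ext)
    fix h assume h: "h \<in> Hd"
    have "?C {h} <#>\<^bsub>?G\<^esub> (?C H #>\<^bsub>?G\<^esub> x) = (?C {h} <#>\<^bsub>?G\<^esub> ?C H) #>\<^bsub>?G\<^esub> x"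
      using C_sub(1) C_sub(2)[OF h] that by (intro G.setmult_rcos_assoc subgroup.subset)
    also have "?C {h} <#>\<^bsub>?G\<^esub> ?C H = ?C {h}"
      using C_sub(1) C_sub(2)[OF h] Hd(2)[OF h]
      by (intro G.subgroup_mult_subset_eq centralizer_subset_centralizer_singleton)
    finally show "?C {h} <#>\<^bsub>?G\<^esub> (?C H #>\<^bsub>?G\<^esub> x) = ?C {h} #>\<^bsub>?G\<^esub> x" .
  qed
  have hom: "\<phi> \<in> hom ?Q ?R"
  proof (rule homI)
    fix K assume "K \<in> carrier ?Q"
    then obtain x where x: "x \<in> pseudocentralizer p n H" "K = ?C H #>\<^bsub>?G\<^esub> x"
      by (auto simp: carrier_pc_quotient)
    show "\<phi> K \<in> carrier ?R"
      using x P_sub by (auto simp: \<phi> P_carrier carrier_pc_quotient)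
  next
    fix K L assume "K \<in> carrier ?Q" "L \<in> carrier ?Q"
    then obtain x y where x: "x \<in> pseudocentralizer p n H" "K = ?C H #>\<^bsub>?G\<^esub> x"
      and y: "y \<in> pseudocentralizer p n H" "L = ?C H #>\<^bsub>?G\<^esub> y"
      by (auto simp: carrier_pc_quotient)
    have rcos: "(?C S #>\<^bsub>?G\<^esub> x) <#>\<^bsub>?G\<^esub> (?C S #>\<^bsub>?G\<^esub> y) = ?C S #>\<^bsub>?G\<^esub> (x \<otimes>\<^bsub>?G\<^esub> y)"
      if "S \<subseteq> carrier ?G" for S
      using normal_centralizer_heisenberg[OF that] x y by (intro normal.rcos_sum P_carrier)
    show "\<phi> (K \<otimes>\<^bsub>?Q\<^esub> L) = \<phi> K \<otimes>\<^bsub>?R\<^esub> \<phi> L"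
      using x(1) y(1)
      by (simp add: x(2) y(2) mult_pc_quotient rcos[OF H] \<phi> P_carrier fun_eq_iff rcos[OF Hd(1)])
  qed
  have inj: "inj_on \<phi> (carrier ?Q)"
  proof (rule inj_onI)
    fix K L assume KL: "K \<in> carrier ?Q" "L \<in> carrier ?Q" and eq: "\<phi> K = \<phi> L"
    obtain x y where x: "x \<in> carrier ?G" "K = ?C H #>\<^bsub>?G\<^esub> x"
      and y: "y \<in> carrier ?G" "L = ?C H #>\<^bsub>?G\<^esub> y"
      using KL P_carrier unfolding carrier_pc_quotient by blast
    \<comment> \<open>The cosets of \<open>x\<close> and \<open>y\<close> agree once this quotient
      centralizes \<open>H\<close>. Central elements of \<open>H\<close> impose nothing; each
      remaining \<open>h\<close> is handled by the component of \<open>\<phi>\<close> at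
      \<open>h\<close>.\<close>
    define z where "z = x \<otimes>\<^bsub>?G\<^esub> inv\<^bsub>?G\<^esub> y"
    have z: "z \<in> carrier ?G" "x = z \<otimes>\<^bsub>?G\<^esub> y"
      using x(1) y(1) by (simp_all add: z_def G.m_assoc)
    have "z \<otimes>\<^bsub>?G\<^esub> h = h \<otimes>\<^bsub>?G\<^esub> z" if h: "h \<in> H" for h
    proof (cases "h \<in> center ?G")
      case True
      then show ?thesis
        using z(1) by (auto simp: center_def centralizer_def)
    next
      case False
      with h have h: "h \<in> Hd"
        by (simp add: assms(5))
      have "\<phi> K h = \<phi> L h"
        by (simp add: eq)
      then have "?C {h} #>\<^bsub>?G\<^esub> x = ?C {h} #>\<^bsub>?G\<^esub> y"
        using h x y by (simp add: \<phi>)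
      then have "x \<in> ?C {h} #>\<^bsub>?G\<^esub> y"
        using G.rcos_self[OF x(1) C_sub(2)[OF h]] by simp
      then obtain c where "c \<in> ?C {h}" "x = c \<otimes>\<^bsub>?G\<^esub> y"
        by (auto simp: r_coset_def)
      moreover from this have "c = z"
        using z y(1) by (auto simp: centralizer_def)
      ultimately show ?thesis
        by (simp add: centralizer_def)
    qed
    then have "z \<in> ?C H"
      using z(1) by (simp add: centralizer_def)
    then have "x \<in> ?C H #>\<^bsub>?G\<^esub> y"
      using z(2) by (auto simp: r_coset_def)
    then show "K = L"
      using G.repr_independence[OF _ y(1) C_sub(1)] x y by simp
  qed
  \<comment> \<open>Restricting the codomain to the image makes the injective homomorphism
    onto.\<close>
  have iso: "\<phi> \<in> iso ?Q (?R\<lparr>carrier := \<phi> ` carrier ?Q\<rparr>)"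
    using hom inj by (auto simp: iso_iff hom_def)
  obtain k where k: "k = 1 \<or> k = 2 \<and> (\<nexists>h. H = {h})" "?Q \<cong> cyclic_power p k"
    using pc_quotient_structure[OF assms(1,2) H assms(4)] by blast
  have "?R\<lparr>carrier := \<phi> ` carrier ?Q\<rparr> \<cong> cyclic_power p k"
    using group.iso_sym[OF group_pc_quotient[OF H] is_isoI[OF iso]] k(2) iso_trans by blast
  with k have "\<exists>k\<in>{1, 2}. ?R\<lparr>carrier := \<phi> ` carrier ?Q\<rparr> \<cong> cyclic_power p k \<and> ?Q \<cong> cyclic_power p k"
    by blast
  with hom_diag prod hom iso \<phi> P_carrier show ?thesis
    by blast
qed

end
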